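(* Let $G\in\varepsilon_{23}$ and let $C,C'$ be two cycles of $G$ whose intersection is a path $P_t$ with $t>0$ edges. If both $C,C'$ are of type $2$, or one is of type $2$ and the other of type $3$, then $t$ is odd. If both are of type $3$, then $t$ is even.
   Context: All graphs are finite, simple and connected. An Euler graph is a connected graph all of whose nodes have even degree. A cycle of length $n$ is of type $i$ if $n\equiv i\pmod 4$. $\varepsilon_{23}$ is the class of Euler graphs in which every cycle has length $\equiv 2$ or $\equiv 3\pmod 4$ and which contain at least one cycle of each of the types $2$ and $3$. *)

theory Defs
  imports "Graph_Theory.Graph_Theory" "HOL-Number_Theory.Cong"
begin

text \<open>
  A finite simple graph is a \<^const>\<open>pair_graph\<close>: an undirected edge uv is the pair of arcs
  (u,v), (v,u). Cycles and paths are subgraphs, i.e. graphs of the same kind, so that they can be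
  intersected.
\<close>

definition walk_graph :: "'a \<Rightarrow> ('a \<times> 'a) awalk \<Rightarrow> 'a pair_pre_digraph" where
  "walk_graph u p = \<lparr> pverts = set (pawalk_verts u p), parcs = set p \<union> (set p)\<inverse> \<rparr>"

definition path_graph :: "nat \<Rightarrow> 'a pair_pre_digraph \<Rightarrow> bool" where
  "path_graph t P \<longleftrightarrow>
     (\<exists>u p v. pre_digraph.apath (with_proj P) u p v \<and> length p = t \<and> P = walk_graph u p)"

text \<open>
  The bound 3 is needed because \<^const>\<open>pre_digraph.cycle\<close> counts the walk u, v, u along a single
  undirected edge as a (directed) cycle of length 2.
\<close>

definition cycle_graph :: "nat \<Rightarrow> 'a pair_pre_digraph \<Rightarrow> bool" where
  "cycle_graph n C \<longleftrightarrow> 3 \<le> n \<and>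
     (\<exists>p. pre_digraph.cycle (with_proj C) p \<and> length p = n \<and> C = walk_graph (fst (hd p)) p)"

definition cycle_in :: "'a pair_pre_digraph \<Rightarrow> 'a pair_pre_digraph \<Rightarrow> bool" where
  "cycle_in G C \<longleftrightarrow> subgraph (with_proj C) (with_proj G) \<and> (\<exists>n. cycle_graph n C)"

definition cycle_type :: "nat \<Rightarrow> 'a pair_pre_digraph \<Rightarrow> bool" where
  "cycle_type i C \<longleftrightarrow> (\<exists>n. cycle_graph n C \<and> [n = i] (mod 4))"

definition graph_inter ::
  "'a pair_pre_digraph \<Rightarrow> 'a pair_pre_digraph \<Rightarrow> 'a pair_pre_digraph" where
  "graph_inter H K = \<lparr> pverts = pverts H \<inter> pverts K, parcs = parcs H \<inter> parcs K \<rparr>"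

text \<open>In a symmetric digraph the degree of a node is its out-degree.\<close>

definition euler_graph :: "'a pair_pre_digraph \<Rightarrow> bool" where
  "euler_graph G \<longleftrightarrow> pair_graph G \<and> Digraph_Component.connected (with_proj G) \<and>
     (\<forall>v \<in> pverts G. even (out_degree (with_proj G) v))"

definition eps23 :: "'a pair_pre_digraph set" where
  "eps23 = {G. euler_graph G \<and>
     (\<forall>C. cycle_in G C \<longrightarrow> cycle_type 2 C \<or> cycle_type 3 C) \<and>
     (\<exists>C. cycle_in G C \<and> cycle_type 2 C) \<and>
     (\<exists>C. cycle_in G C \<and> cycle_type 3 C)}"

lemma cycle_graph_card_pverts:
  assumes "cycle_graph n C"
  shows "card (pverts C) = n"
proof -
  obtain p u where p: "length p = n" "C = walk_graph (fst (hd p)) p" "p \<noteq> []" "pcas u p u"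
      "distinct (tl (pawalk_verts u p))"
    using assms unfolding cycle_graph_def pre_digraph.cycle_def pre_digraph.awalk_def
      cas_with_proj_eq awalk_verts_with_proj_eq by blast
  have len: "length (pawalk_verts w q) = Suc (length q)" for w :: 'a and q
    by (induction q arbitrary: w) auto
  have lst: "pcas w q v \<Longrightarrow> last (pawalk_verts w q) = v" for w v :: 'a and q
  proof (induction q arbitrary: w)
    case (Cons e q)
    have "pawalk_verts (snd e) q \<noteq> []"
      using len[of "snd e" q] by auto
    with Cons show ?case by auto
  qed simp
  obtain e q where e: "p = e # q"
    using p(3) by (cases p) auto
  have u: "fst e = u" and "last (pawalk_verts (snd e) q) = u"
    using p(4) lst[of "snd e" q u] by (auto simp: e)
  moreover have "pawalk_verts (snd e) q \<noteq> []"
    using len[of "snd e" q] by auto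
  ultimately have "u \<in> set (pawalk_verts (snd e) q)"
    using last_in_set by metis
  then have "pverts C = set (pawalk_verts (snd e) q)"
    using u by (auto simp: p(2) e walk_graph_def)
  moreover have "distinct (pawalk_verts (snd e) q)"
    using p(5) by (simp add: e)
  ultimately show ?thesis
    using p(1) len[of "snd e" q] by (simp add: distinct_card e)
qed

end

theory Submission
  imports Defs
begin

text \<open>
  Cut both cycles along the common path with vertices \<open>ys\<close>, so that their vertices read
  \<open>ys @ zs\<close> and \<open>ys @ zs'\<close> in cyclic order. Walking along \<open>zs\<close> from the end of the path to its
  start and back along \<open>zs'\<close> is a third cycle, of length \<open>n + n' - 2 * t\<close>. All three lengths are
  2 or 3 modulo 4, which determines the parity of \<open>t\<close>.
\<close>

section \<open>Paths and cycles as vertex lists\<close>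

text \<open>Vertex lists can be rotated, reversed and cut more easily than arc walks. Each edge
  enters with both orientations, as in \<open>walk_graph\<close>, so the set does not depend on the
  direction of traversal.\<close>

fun path_arcs :: "'a list \<Rightarrow> ('a \<times> 'a) set" where
  "path_arcs (x # y # xs) = {(x, y), (y, x)} \<union> path_arcs (y # xs)"
| "path_arcs _ = {}"

text \<open>The pair added to \<open>path_arcs\<close> is the closing edge. A genuine cycle arises
  only from at least three distinct entries: one entry gives a loop, and for two the closing edge is
  the path edge again.\<close>

definition cyc_arcs :: "'a list \<Rightarrow> ('a \<times> 'a) set" where
  "cyc_arcs xs = path_arcs xs \<union> {(last xs, hd xs), (hd xs, last xs)}"

lemma path_arcs_append:
  assumes "xs \<noteq> []" "ys \<noteq> []"
  shows "path_arcs (xs @ ys) =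
    path_arcs xs \<union> path_arcs ys \<union> {(last xs, hd ys), (hd ys, last xs)}"
  using assms
proof (induction xs rule: path_arcs.induct)
  case ("2_2" x)
  then show ?case by (cases ys) auto
qed auto

lemma path_arcs_rev: "path_arcs (rev xs) = path_arcs xs"
proof (induction xs rule: path_arcs.induct)
  case (1 x y xs)
  have "path_arcs (rev (x # y # xs)) = path_arcs (rev (y # xs) @ [x])"
    by simp
  also have "\<dots> = path_arcs (rev (y # xs)) \<union> {(y, x), (x, y)}"
    by (subst path_arcs_append) (auto simp: last_rev)
  finally show ?case
    using 1 by auto
qed auto

lemma path_arcs_subset: "path_arcs xs \<subseteq> set xs \<times> set xs"
  by (induction xs rule: path_arcs.induct) auto

lemma path_arcs_split:
  "(a, b) \<in> path_arcs xs \<Longrightarrow>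
    \<exists>ys zs. xs = ys @ a # b # zs \<or> xs = ys @ b # a # zs"
proof (induction xs rule: path_arcs.induct)
  case (1 x y xs)
  show ?case
  proof (cases "(a, b) \<in> path_arcs (y # xs)")
    case True
    then obtain ys zs where "y # xs = ys @ a # b # zs \<or> y # xs = ys @ b # a # zs"
      using 1 by blast
    then have "x # y # xs = (x # ys) @ a # b # zs \<or> x # y # xs = (x # ys) @ b # a # zs"
      by simp
    then show ?thesis by blast
  next
    case False
    then have "x # y # xs = [] @ a # b # xs \<or> x # y # xs = [] @ b # a # xs"
      using 1 by auto
    then show ?thesis by blast
  qed
qed auto

text \<open>The edge joining the two blocks and the closing edge trade places.\<close>

lemma cyc_arcs_rotate: "cyc_arcs (xs @ ys) = cyc_arcs (ys @ xs)"
  by (cases "xs = [] \<or> ys = []") (auto simp: cyc_arcs_def path_arcs_append)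

lemma cyc_arcs_rev: "cyc_arcs (rev xs) = cyc_arcs xs"
  by (cases "xs = []") (auto simp: cyc_arcs_def path_arcs_rev hd_rev last_rev)

lemma cyc_arcs_subset: "xs \<noteq> [] \<Longrightarrow> cyc_arcs xs \<subseteq> set xs \<times> set xs"
  using path_arcs_subset[of xs] by (auto simp: cyc_arcs_def)

section \<open>Cutting a cycle open along a path\<close>

text \<open>Rotation brings the edge to the front, and a reversal corrects its orientation. The
  multiset is tracked because it carries vertex set, length and distinctness at once.\<close>

lemma cyc_arcs_cut_arc:
  assumes "(a, b) \<in> cyc_arcs xs" "length xs \<ge> 2"
  shows "\<exists>zs. mset (a # b # zs) = mset xs \<and> cyc_arcs (a # b # zs) = cyc_arcs xs"
proof -
  \<comment> \<open>The second alternative is the closing edge. Providing both orientations here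
    lets two instances, with \<open>c\<close> and \<open>d\<close> exchanged, cover all four
    positions of the arc.\<close>
  have cut: "\<exists>zs. mset (c # d # zs) = mset xs \<and> cyc_arcs (c # d # zs) = cyc_arcs xs \<and>
      mset (d # c # rev zs) = mset xs \<and> cyc_arcs (d # c # rev zs) = cyc_arcs xs"
    if "xs = ys @ c # d # ws \<or> xs = d # ws @ [c]" for c d ys ws
    using that
  proof
    assume xs: "xs = ys @ c # d # ws"
    have "cyc_arcs (c # d # ws @ ys) = cyc_arcs xs"
      using cyc_arcs_rotate[of "c # d # ws" ys] by (simp add: xs)
    moreover have "cyc_arcs (d # c # rev (ws @ ys)) = cyc_arcs (c # d # ws @ ys)"
      using cyc_arcs_rotate[of "[d, c]" "rev (ws @ ys)"] cyc_arcs_rev[of "c # d # ws @ ys"]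
      by simp
    ultimately show ?thesis
      by (intro exI[of _ "ws @ ys"]) (simp add: xs)
  next
    assume xs: "xs = d # ws @ [c]"
    have "cyc_arcs (c # d # ws) = cyc_arcs xs"
      using cyc_arcs_rotate[of "[c]" "d # ws"] by (simp add: xs)
    moreover have "cyc_arcs (d # c # rev ws) = cyc_arcs (c # d # ws)"
      using cyc_arcs_rotate[of "[d, c]" "rev ws"] cyc_arcs_rev[of "c # d # ws"]
      by simp
    ultimately show ?thesis
      by (intro exI[of _ ws]) (simp add: xs)
  qed
  obtain x ws y where xs: "xs = x # ws @ [y]"
    using assms(2) by (cases xs; cases "tl xs" rule: rev_cases) auto
  have "(a, b) \<in> path_arcs xs \<or> xs = b # ws @ [a] \<or> xs = a # ws @ [b]"
    using assms(1) by (auto simp: cyc_arcs_def xs)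
  then obtain ys vs where "xs = ys @ a # b # vs \<or> xs = b # vs @ [a] \<or>
      xs = ys @ b # a # vs \<or> xs = a # vs @ [b]"
    using path_arcs_split[of a b xs] by blast
  then show ?thesis
    using cut[of ys a b vs] cut[of ys b a vs] by blast
qed

text \<open>Induction along the path. Its first edge is placed by \<open>cyc_arcs_cut_arc\<close>,
  which fixes the direction of traversal; from then on each further path vertex is forced to be the
  next one on the cycle, so only the boundary between \<open>ys\<close> and \<open>zs\<close>
  moves.\<close>

lemma cyc_arcs_cut_path:
  assumes "path_arcs ys \<subseteq> cyc_arcs xs" "distinct ys" "length ys \<ge> 2" "distinct xs"
    "length xs \<ge> 2"
  shows "\<exists>zs. mset (ys @ zs) = mset xs \<and> cyc_arcs (ys @ zs) = cyc_arcs xs"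
  using assms(1-3)
proof (induction ys rule: rev_induct)
  case (snoc c ys)
  show ?case
  proof (cases "length ys \<ge> 2")
    case False
    then obtain a where ys: "ys = [a]"
      using snoc.prems by (cases ys; cases "tl ys") auto
    then have "(a, c) \<in> cyc_arcs xs"
      using snoc.prems by simp
    then show ?thesis
      using cyc_arcs_cut_arc[of a c xs] assms(5) by (auto simp: ys)
  next
    case True
    then have arcs: "path_arcs (ys @ [c]) = path_arcs ys \<union> {(last ys, c), (c, last ys)}"
      by (subst path_arcs_append) auto
    \<comment> \<open>A nonempty \<open>us\<close> separates \<open>b\<close> from the start of the
      path, where the closing edge is attached.\<close>
    obtain us b where ys: "ys = us @ [b]" "us \<noteq> []"
      using True by (cases ys rule: rev_cases) force+
    obtain zs where zs: "mset (ys @ zs) = mset xs" "cyc_arcs (ys @ zs) = cyc_arcs xs"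
      using snoc.IH snoc.prems arcs True by auto
    have dist: "distinct (ys @ zs)"
      using zs(1) assms(4) mset_eq_imp_distinct_iff by blast
    have bc: "(b, c) \<in> cyc_arcs (ys @ zs)"
      using snoc.prems(1) zs(2) ys(1) unfolding arcs by auto
    have c: "c \<notin> set ys"
      using snoc.prems(2) by simp
    have "c \<in> set zs"
      using cyc_arcs_subset[of "ys @ zs"] bc c ys by auto
    then have zs_ne: "zs \<noteq> []" by auto
    \<comment> \<open>The neighbours of \<open>b\<close> on the cycle are the last vertex of \<open>us\<close> and the first of \<open>zs\<close>.\<close>
    have "cyc_arcs (ys @ zs) = path_arcs ys \<union> path_arcs zs \<union> {(b, hd zs), (hd zs, b)}
        \<union> {(last zs, hd us), (hd us, last zs)}"
      using zs_ne ys path_arcs_append[of ys zs] by (simp add: cyc_arcs_def)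
    moreover have "b \<notin> set zs" "b \<noteq> hd us"
      using dist ys by (auto simp: hd_in_set)
    ultimately have "c = hd zs"
      using bc c zs_ne path_arcs_subset[of ys] path_arcs_subset[of zs] ys last_in_set[of zs]
      by auto
    then have "ys @ zs = (ys @ [c]) @ tl zs"
      using zs_ne by simp
    then show ?thesis
      using zs by metis
  qed
qed simp

section \<open>The third cycle of a theta graph\<close>

text \<open>The new closed list consists of two stretches between the ends of \<open>ys\<close>, one
  through \<open>zs\<close> and one through \<open>zs'\<close>. Each stretch is already contained in
  one of the given cycles.\<close>

lemma cyc_arcs_theta:
  assumes "cyc_arcs (ys @ zs) \<subseteq> A" "cyc_arcs (ys @ zs') \<subseteq> A" "ys \<noteq> []"
  shows "cyc_arcs (last ys # zs @ hd ys # rev zs') \<subseteq> A"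
proof -
  have sub: "path_arcs (last ys # zs @ [hd ys]) \<subseteq> A" if "cyc_arcs (ys @ zs) \<subseteq> A" for zs
  proof (cases "zs = []")
    \<comment> \<open>Without inner vertices the stretch is just the closing edge of
      \<open>ys\<close>.\<close>
    case True
    then show ?thesis using that assms(3) by (auto simp: cyc_arcs_def)
  next
    case False
    have "path_arcs ([last ys] @ zs @ [hd ys]) \<subseteq> cyc_arcs (ys @ zs)"
      using False assms(3)
      by (auto simp: cyc_arcs_def path_arcs_append simp del: append.simps(2))
    then show ?thesis using that by simp
  qed
  have "cyc_arcs (last ys # zs @ hd ys # rev zs') =
      path_arcs (last ys # zs @ [hd ys]) \<union> path_arcs (last ys # zs' @ [hd ys])"
  proof -
    have "path_arcs (last ys # zs' @ [hd ys]) = path_arcs ([hd ys] @ rev zs' @ [last ys])"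
      using path_arcs_rev[of "last ys # zs' @ [hd ys]"] by simp
    moreover have "cyc_arcs ((last ys # zs @ [hd ys]) @ rev zs') =
      path_arcs (last ys # zs @ [hd ys]) \<union> path_arcs ([hd ys] @ rev zs' @ [last ys])"
      by (cases "zs' = []")
        (auto simp: cyc_arcs_def path_arcs_append simp del: path_arcs.simps(1) append.simps(2))
    ultimately show ?thesis by simp
  qed
  then show ?thesis
    using sub assms(1,2) by simp
qed

section \<open>Translation between arc walks and vertex lists\<close>

lemma pcas_map_fst:
  "pcas u p v \<Longrightarrow> pawalk_verts u p = map fst p @ [v]"
  by (induction p arbitrary: u) auto

lemma pcas_path_arcs:
  "pcas u p v \<Longrightarrow> set p \<union> (set p)\<inverse> = path_arcs (pawalk_verts u p)"
proof (induction p arbitrary: u)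
  case (Cons e p)
  then have "set p \<union> (set p)\<inverse> = path_arcs (pawalk_verts (snd e) p)"
    by auto
  moreover obtain vs where "pawalk_verts (snd e) p = snd e # vs"
    using Cons.prems by (cases p) auto
  ultimately have "path_arcs (pawalk_verts u (e # p)) =
      {(fst e, snd e), (snd e, fst e)} \<union> (set p \<union> (set p)\<inverse>)"
    by simp
  then show ?case by auto
qed simp

text \<open>Supplies the arc walk when a cycle is built from a vertex list.\<close>

lemma pcas_zip_tl:
  "xs \<noteq> [] \<Longrightarrow> pcas (hd xs) (zip xs (tl xs)) (last xs) \<and>
    pawalk_verts (hd xs) (zip xs (tl xs)) = xs"
proof (induction xs)
  case (Cons x xs)
  then show ?case by (cases xs) auto
qed simp

lemma path_graphD:
  assumes "path_graph t P"
  shows "\<exists>xs. distinct xs \<and> length xs = Suc t \<and> pverts P = set xs \<and> parcs P = path_arcs xs"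
proof -
  obtain u p v where p: "pcas u p v" "distinct (pawalk_verts u p)" "length p = t"
      "P = walk_graph u p"
    using assms unfolding path_graph_def pre_digraph.apath_def pre_digraph.awalk_def
      cas_with_proj_eq awalk_verts_with_proj_eq by blast
  then show ?thesis
    using pcas_path_arcs[OF p(1)] pcas_map_fst[OF p(1)]
    by (intro exI[of _ "pawalk_verts u p"]) (simp add: walk_graph_def)
qed

text \<open>The closed walk visits its start twice; dropping the final visit gives the list
  \<open>xs\<close>, and the last arc of the walk becomes the closing edge. One direction unpacks
  the given cycles, the other certifies the third.\<close>

lemma cycle_graph_iff:
  "cycle_graph n C \<longleftrightarrow> 3 \<le> n \<and>
    (\<exists>xs. distinct xs \<and> length xs = n \<and> C = \<lparr>pverts = set xs, parcs = cyc_arcs xs\<rparr>)"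
proof (intro iffI conjI; (elim conjE exE)?)
  assume C: "cycle_graph n C"
  then show "3 \<le> n"
    by (simp add: cycle_graph_def)
  obtain p u where p: "length p = n" "C = walk_graph (fst (hd p)) p" "p \<noteq> []" "pcas u p u"
      "distinct (tl (pawalk_verts u p))"
    using C unfolding cycle_graph_def pre_digraph.cycle_def pre_digraph.awalk_def
      cas_with_proj_eq awalk_verts_with_proj_eq by blast
  have u: "fst (hd p) = u"
    using p(3,4) by (cases p) auto
  have verts: "pawalk_verts u p = map fst p @ [u]"
    using p(4) by (rule pcas_map_fst)
  have "distinct (map fst p)"
    using p(3,5) u unfolding verts by (cases p) auto
  moreover have "path_arcs (map fst p @ [u]) = cyc_arcs (map fst p)"
    using p(3) u by (simp add: cyc_arcs_def path_arcs_append hd_map)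
  moreover have "u \<in> fst ` set p"
    using p(3) u by (metis hd_in_set imageI)
  ultimately show
    "\<exists>xs. distinct xs \<and> length xs = n \<and> C = \<lparr>pverts = set xs, parcs = cyc_arcs xs\<rparr>"
    using p(1,2) u verts pcas_path_arcs[OF p(4)]
    by (intro exI[of _ "map fst p"]) (auto simp: walk_graph_def)
next
  fix xs
  assume n: "3 \<le> n" and xs: "distinct xs" "length xs = n"
    and C: "C = \<lparr>pverts = set xs, parcs = cyc_arcs xs\<rparr>"
  have ne: "xs \<noteq> []" using n xs by auto
  \<comment> \<open>Repeating the first vertex at the end makes the last of the
    \<open>length xs\<close> arcs of \<open>p\<close> the closing one.\<close>
  define ys where "ys = xs @ [hd xs]"
  define p where "p = zip ys (tl ys)"
  have hd: "hd ys = hd xs" and last: "last ys = hd xs"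
    using ne by (auto simp: ys_def)
  have p: "pcas (hd xs) p (hd xs)" "pawalk_verts (hd xs) p = ys"
    using pcas_zip_tl[of ys] by (auto simp: p_def hd last) (auto simp: ys_def)
  have len: "length p = n"
    using xs by (simp add: p_def ys_def)
  then have p_ne: "p \<noteq> []" using n by auto
  then have hdp: "fst (hd p) = hd xs"
    using p(1) by (cases p) auto
  have arcs: "set p \<union> (set p)\<inverse> = cyc_arcs xs"
    using pcas_path_arcs[OF p(1)] ne by (simp add: p(2) ys_def path_arcs_append cyc_arcs_def)
  have "distinct (tl ys)"
    using xs ne by (cases xs) (auto simp: ys_def)
  then have "pre_digraph.cycle (with_proj C) p"
    unfolding pre_digraph.cycle_def pre_digraph.awalk_def cas_with_proj_eq
      awalk_verts_with_proj_eq
    using p p_ne arcs ne by (intro exI[of _ "hd xs"]) (auto simp: C)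
  moreover have "C = walk_graph (fst (hd p)) p"
    using ne by (auto simp: walk_graph_def hdp p(2) arcs C ys_def)
  ultimately show "cycle_graph n C"
    using n len by (auto simp: cycle_graph_def)
qed

text \<open>The length of a cycle graph is its number of vertices, so the existentially quantified
  length in \<open>cycle_type\<close> can only be \<open>n\<close>.\<close>

lemma cycle_type_iff:
  "cycle_graph n C \<Longrightarrow> cycle_type i C \<longleftrightarrow> n mod 4 = i mod 4"
  by (metis cycle_type_def cycle_graph_card_pverts cong_def)

lemma cycle_inI:
  assumes "wf_digraph (with_proj G)" "distinct xs" "3 \<le> length xs" "set xs \<subseteq> pverts G"
    "cyc_arcs xs \<subseteq> parcs G"
  shows "cycle_in G \<lparr>pverts = set xs, parcs = cyc_arcs xs\<rparr>"
proof -
  have "xs \<noteq> []" using assms by auto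
  then have "wf_digraph (with_proj \<lparr>pverts = set xs, parcs = cyc_arcs xs\<rparr>)"
    using cyc_arcs_subset[of xs] by (auto simp: wf_digraph_def)
  then show ?thesis
    using assms unfolding cycle_in_def
    by (auto simp: subgraph_def compatible_def cycle_graph_iff)
qed

section \<open>Parity of the common path\<close>

theorem theorem23:
  fixes G C C' :: "'a pair_pre_digraph" and t :: nat
  assumes "G \<in> eps23"
    and "cycle_in G C" and "cycle_in G C'"
    and "path_graph t (graph_inter C C')" and "t > 0"
  shows "((cycle_type 2 C \<and> cycle_type 2 C') \<or>
          (cycle_type 2 C \<and> cycle_type 3 C') \<or>
          (cycle_type 3 C \<and> cycle_type 2 C') \<longrightarrow> odd t) \<and>
         (cycle_type 3 C \<and> cycle_type 3 C' \<longrightarrow> even t)"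
proof -
  obtain n xs where n: "cycle_graph n C" "3 \<le> n" "distinct xs" "length xs = n"
      "C = \<lparr>pverts = set xs, parcs = cyc_arcs xs\<rparr>"
    using assms(2) unfolding cycle_in_def cycle_graph_iff by blast
  obtain n' xs' where n': "cycle_graph n' C'" "3 \<le> n'" "distinct xs'" "length xs' = n'"
      "C' = \<lparr>pverts = set xs', parcs = cyc_arcs xs'\<rparr>"
    using assms(3) unfolding cycle_in_def cycle_graph_iff by blast
  obtain ys where ys: "distinct ys" "length ys = Suc t" "set xs \<inter> set xs' = set ys"
      "cyc_arcs xs \<inter> cyc_arcs xs' = path_arcs ys"
    using path_graphD[OF assms(4)] by (auto simp: graph_inter_def n(5) n'(5))
  obtain zs where zs: "mset (ys @ zs) = mset xs" "cyc_arcs (ys @ zs) = cyc_arcs xs"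
    using cyc_arcs_cut_path[of ys xs] ys n \<open>t > 0\<close> by auto
  obtain zs' where zs': "mset (ys @ zs') = mset xs'" "cyc_arcs (ys @ zs') = cyc_arcs xs'"
    using cyc_arcs_cut_path[of ys xs'] ys n' \<open>t > 0\<close> by auto
  have set: "set xs = set ys \<union> set zs" "set xs' = set ys \<union> set zs'"
    using mset_eq_setD[OF zs(1)] mset_eq_setD[OF zs'(1)] by auto
  have dist: "distinct (ys @ zs)" "distinct (ys @ zs')"
    using zs(1) zs'(1) n(3) n'(3) mset_eq_imp_distinct_iff by blast+
  have len: "n = Suc t + length zs" "n' = Suc t + length zs'"
    using mset_eq_length[OF zs(1)] mset_eq_length[OF zs'(1)] n(4) n'(4) ys(2) by auto
  \<comment> \<open>A common vertex would lie on both cycles, hence on \<open>ys\<close>, against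
    distinctness.\<close>
  have disj: "set zs \<inter> set zs' = {}"
    using ys(3) dist by (auto simp: set)
  obtain a us b where us: "ys = a # us @ [b]"
    using ys(2) \<open>t > 0\<close> by (cases ys; cases "tl ys" rule: rev_cases) auto
  \<comment> \<open>Otherwise both cycles close the path by the same edge, which then lies in the intersection.\<close>
  have ne: "zs \<noteq> [] \<or> zs' \<noteq> []"
  proof (rule ccontr)
    assume "\<not> ?thesis"
    then have "zs = []" "zs' = []" by auto
    then have "(a, b) \<in> path_arcs ys" and "us \<noteq> []"
      using ys(2,4) zs(2) zs'(2) n(2) len(1) by (auto simp: cyc_arcs_def us)
    \<comment> \<open>On the path the end \<open>a\<close> is adjacent only to \<open>hd us\<close>,
      which differs from \<open>b\<close>.\<close>
    moreover have "path_arcs ys = {(a, hd us), (hd us, a)} \<union> path_arcs (us @ [b])"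
      using \<open>us \<noteq> []\<close> by (cases us) (auto simp: us)
    ultimately show False
      using ys(1) path_arcs_subset[of "us @ [b]"] by (auto simp: us)
  qed
  define ws where "ws = last ys # zs @ hd ys # rev zs'"
  have G: "wf_digraph (with_proj G)" "set xs \<subseteq> pverts G" "set xs' \<subseteq> pverts G"
      "cyc_arcs xs \<subseteq> parcs G" "cyc_arcs xs' \<subseteq> parcs G"
    using assms(2,3) by (auto simp: cycle_in_def subgraph_def n(5) n'(5))
  have "cyc_arcs ws \<subseteq> parcs G"
    unfolding ws_def using G(4,5) zs(2) zs'(2) ys(2) by (intro cyc_arcs_theta) force+
  moreover have "distinct ws"
    using dist disj by (auto simp: ws_def us)
  moreover have "set ws \<subseteq> pverts G"
    using G(2,3) by (auto simp: ws_def set us)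
  moreover have len_ws: "length ws = length zs + length zs' + 2"
    by (simp add: ws_def)
  \<comment> \<open>By \<open>ne\<close> the third cycle does not collapse to a single edge
    traversed back and forth.\<close>
  moreover have "3 \<le> length ws"
    using ne len_ws by (cases zs; cases zs') auto
  ultimately have ws: "cycle_in G \<lparr>pverts = set ws, parcs = cyc_arcs ws\<rparr>"
      "cycle_graph (length ws) \<lparr>pverts = set ws, parcs = cyc_arcs ws\<rparr>"
    using G(1) by (auto intro!: cycle_inI simp: cycle_graph_iff)
  then have "length ws mod 4 = 2 \<or> length ws mod 4 = 3"
    using assms(1) cycle_type_iff[OF ws(2)] unfolding eps23_def by auto
  \<comment> \<open>Both \<open>n\<close> and \<open>n'\<close> count all \<open>Suc t\<close> path
    vertices, while \<open>ws\<close> keeps only the two ends. The additive form avoids truncated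
    subtraction.\<close>
  moreover have "length ws + 2 * t = n + n'"
    by (simp add: len len_ws)
  then have "(length ws mod 4 + (2 * t) mod 4) mod 4 = (n mod 4 + n' mod 4) mod 4"
    by (simp only: mod_add_eq)
  moreover have "(2 * t) mod 4 = (if even t then 0 else 2)"
    by presburger
  \<comment> \<open>Modulo 4, \<open>n + n'\<close> is 0 for types 2 and 2, 1 for types 2 and 3, and
    2 for types 3 and 3. An even \<open>t\<close> would leave the third cycle with residue 0 or 1 in
    the first two cases, and an odd \<open>t\<close> with residue 0 in the last;
    \<open>eps23\<close> excludes these.\<close>
  ultimately show ?thesis
    unfolding cycle_type_iff[OF n(1)] cycle_type_iff[OF n'(1)] by (auto split: if_splits)
qed

end
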